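(* Let $n\ge4$, and let $D_n^{+}$ and $D_n^{-}$ be the determinants of the $n\times n$ Gram matrices $\Delta^n_{n-2,+}$ and $\Delta^n_{n-2,-}$ of the standard modules of the height-$0$ short Brauer algebra of rank $n$ with $n-2$ propagating lines and symmetric, respectively antisymmetric, $S_2$-label, with loop parameter $\delta=x$. Then $$D_n^{+}=(x-1)\left[(x+2)(x-1)\,d_{n-3}-2x\,d_{n-4}\right],$$ $$D_n^{-}=(x-1)(x+2)\left[(x-1)\,d_{n-3}-2\,d_{n-4}\right],$$ where $d_j$ are the Chebyshev polynomials determined by $d_0=1$, $d_1=x$, $d_{j+2}=x\,d_{j+1}-d_j$.
   Context: Here $x$ is an indeterminate (the loop parameter). The diagram basis of the standard module with $n-2$ propagating lines consists of the $n$ half-diagrams on vertices $1,\dots,n$ having exactly one arc, the arc being one of, in this order, $\{1,2\},\{1,3\},\{2,3\},\{3,4\},\{4,5\},\dots,\{n-1,n\}$, the remaining $n-2$ vertices carrying propagating lines (with the symmetrizer, for the label $+$, or the antisymmetrizer, for the label $-$, on the first two propagating lines). The natural contravariant form is computed by gluing two half-diagrams along the vertices: the value is $x$ for two equal half-diagrams (one closed loop), $0$ if the gluing has fewer than $n-2$ propagating lines, and otherwise $1$, respectively $\pm1$ according to the sign of the label, if the induced permutation of the propagating lines is trivial, respectively the transposition of the first two lines. Explicitly, $\Delta^n_{n-2,\pm}$ is the symmetric $n\times n$ matrix with all diagonal entries $x$; entries $(j,j+1)$ equal to $1$ for $1\le j\le n-1$; entry $(1,3)$ equal to $1$; entry $(2,4)$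 equal to $+1$ for the label $+$ and $-1$ for the label $-$; these entries reflected by symmetry; and all other entries $0$. For example $$\Delta^4_{2,\pm}=\begin{pmatrix}x&1&1&0\\1&x&1&\pm1\\1&1&x&1\\0&\pm1&1&x\end{pmatrix}.$$ *)

theory Defs
  imports "Jordan_Normal_Form.Determinant" "HOL-Combinatorics.Transposition"
begin

section \<open>Half-diagrams and their gluing\<close>

text \<open>
  A half-diagram on the vertices \<open>1, \<dots>, n\<close> is given by the set of its arcs, pairwise disjoint
  two-element sets of vertices. Every vertex on no arc carries a propagating line; the
  propagating lines are numbered from 1, from left to right.
\<close>

type_synonym half_diagram = "nat set set"

definition line_vertices :: "nat \<Rightarrow> half_diagram \<Rightarrow> nat set" where
  "line_vertices n u = {1..n} - \<Union>u"

definition line_number :: "nat \<Rightarrow> half_diagram \<Rightarrow> nat \<Rightarrow> nat" where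
  "line_number n u a = card {b \<in> line_vertices n u. b \<le> a}"

definition connected_in_gluing :: "half_diagram \<Rightarrow> half_diagram \<Rightarrow> (nat \<times> nat) set" where
  "connected_in_gluing u v = (\<Union>e \<in> u \<union> v. e \<times> e)\<^sup>*"

definition closed_loops :: "nat \<Rightarrow> half_diagram \<Rightarrow> half_diagram \<Rightarrow> nat set set" where
  "closed_loops n u v =
     {C \<in> {1..n} // connected_in_gluing u v.
        C \<inter> line_vertices n u = {} \<and> C \<inter> line_vertices n v = {}}"

text \<open>
  A propagating line of the gluing is a component running from a line of \<open>u\<close> to a line of \<open>v\<close>.
  It is recorded by the two vertices at which these lines are attached.
\<close>

definition propagating_lines :: "nat \<Rightarrow> half_diagram \<Rightarrow> half_diagram \<Rightarrow> (nat \<times> nat) set" where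
  "propagating_lines n u v =
     connected_in_gluing u v \<inter> line_vertices n u \<times> line_vertices n v"

definition induces_permutation ::
    "nat \<Rightarrow> half_diagram \<Rightarrow> half_diagram \<Rightarrow> (nat \<Rightarrow> nat) \<Rightarrow> bool" where
  "induces_permutation n u v \<sigma> \<longleftrightarrow>
     (\<forall>(a, b) \<in> propagating_lines n u v. line_number n v b = \<sigma> (line_number n u a))"


section \<open>The contravariant form with \<open>n - 2\<close> propagating lines\<close>

datatype S2_label = Sym_label | Antisym_label

fun label_sign :: "S2_label \<Rightarrow> 'a::comm_ring_1" where
  "label_sign Sym_label = 1"
| "label_sign Antisym_label = -1"

text \<open>
  For the half-diagrams below the induced permutation is always trivial or the transposition
  of the first two lines, so the last alternative does not occur; see \<open>gram_matrix_index\<close>.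
\<close>

definition contravariant_form ::
    "'a::comm_ring_1 \<Rightarrow> S2_label \<Rightarrow> nat \<Rightarrow> half_diagram \<Rightarrow> half_diagram \<Rightarrow> 'a" where
  "contravariant_form \<delta> l n u v =
     (if card (propagating_lines n u v) < n - 2 then 0
      else if induces_permutation n u v id then \<delta> ^ card (closed_loops n u v)
      else if induces_permutation n u v (transpose 1 2)
        then label_sign l * \<delta> ^ card (closed_loops n u v)
      else 0)"

text \<open>The half-diagrams of height 0 with one arc are
  \<open>{1,2}, {1,3}, {2,3}, {3,4}, \<dots>, {n-1,n}\<close>, here numbered from 1 to \<open>n\<close>.\<close>

definition basis_arc :: "nat \<Rightarrow> nat set" where
  "basis_arc k = (if k = 1 then {1, 2} else if k = 2 then {1, 3} else {k - 1, k})"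

definition basis_diagram :: "nat \<Rightarrow> half_diagram" where
  "basis_diagram k = {basis_arc k}"

text \<open>Matrix indices start at 0.\<close>

definition gram_matrix :: "'a::comm_ring_1 \<Rightarrow> S2_label \<Rightarrow> nat \<Rightarrow> 'a mat" where
  "gram_matrix \<delta> l n =
     mat n n (\<lambda>(i, j). contravariant_form \<delta> l n (basis_diagram (Suc i)) (basis_diagram (Suc j)))"


section \<open>Chebyshev polynomials\<close>

abbreviation X :: "'a::comm_ring_1 poly" where
  "X \<equiv> [:0, 1:]"

fun chebyshev :: "nat \<Rightarrow> 'a::comm_ring_1 poly" where
  "chebyshev 0 = 1"
| "chebyshev (Suc 0) = X"
| "chebyshev (Suc (Suc j)) = X * chebyshev (Suc j) - chebyshev j"


section \<open>Explicit form of the Gram matrix\<close>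

lemma connected_in_gluing_subset:
  assumes "\<forall>e \<in> u \<union> v. e \<times> e \<subseteq> R" "refl R" "trans R"
  shows "connected_in_gluing u v \<subseteq> R"
proof -
  have "(\<Union>e \<in> u \<union> v. e \<times> e)\<^sup>* \<subseteq> R\<^sup>*"
    by (rule rtrancl_mono) (simp only: UN_subset_iff, rule assms(1))
  also have "R\<^sup>* = R"
    using assms(2,3) rtrancl_trancl_reflcl[of R] by (simp add: refl_on_def trancl_id sup_absorb1 subset_iff)
  finally show ?thesis by (simp add: connected_in_gluing_def)
qed

lemma connected_in_gluing_arc:
  assumes "e \<in> u \<union> v" "a \<in> e" "b \<in> e"
  shows "(a, b) \<in> connected_in_gluing u v"
  unfolding connected_in_gluing_def
  by (rule r_into_rtrancl) (rule UN_I[OF assms(1)], simp add: assms)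

lemma connected_in_gluing_refl: "(a, a) \<in> connected_in_gluing u v"
  by (simp add: connected_in_gluing_def)

lemma connected_in_gluing_trans:
  "(a, b) \<in> connected_in_gluing u v \<Longrightarrow> (b, c) \<in> connected_in_gluing u v \<Longrightarrow>
   (a, c) \<in> connected_in_gluing u v"
  unfolding connected_in_gluing_def by (rule rtrancl_trans)

lemma refl_trans_blocks:
  fixes A B :: "'a set"
  assumes "A \<inter> B = {}"
  shows "refl (Id \<union> A \<times> A \<union> B \<times> B)" "trans (Id \<union> A \<times> A \<union> B \<times> B)"
proof -
  show "refl (Id \<union> A \<times> A \<union> B \<times> B)" by (simp add: refl_on_def)
  show "trans (Id \<union> A \<times> A \<union> B \<times> B)"
  proof (rule transI)
    fix x y z
    assume xy: "(x, y) \<in> Id \<union> A \<times> A \<union> B \<times> B"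
      and yz: "(y, z) \<in> Id \<union> A \<times> A \<union> B \<times> B"
    show "(x, z) \<in> Id \<union> A \<times> A \<union> B \<times> B"
    proof (cases "x = y \<or> y = z")
      case True
      then show ?thesis using xy yz by metis
    next
      case False
      then have "x \<in> A \<and> y \<in> A \<or> x \<in> B \<and> y \<in> B" "y \<in> A \<and> z \<in> A \<or> y \<in> B \<and> z \<in> B"
        using xy yz by simp_all
      moreover have "\<not> (y \<in> A \<and> y \<in> B)" using assms by (simp add: disjoint_iff)
      ultimately show ?thesis by simp metis
    qed
  qed
qed

lemma refl_trans_block: "refl (Id \<union> A \<times> A)" "trans (Id \<union> A \<times> A)"
  using refl_trans_blocks[of A "{}"] by simp_all

lemma block_subset:
  assumes "\<And>a. (a, a) \<in> R" "\<forall>a\<in>A. \<forall>b\<in>A. (a, b) \<in> R"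
  shows "Id \<union> A \<times> A \<subseteq> R"
  using assms by auto

lemma connected_equal:
  "connected_in_gluing {{p, q}} {{p, q}} = Id \<union> {p, q} \<times> {p, q}" (is "?L = ?R")
proof
  show "?L \<subseteq> ?R"
    by (rule connected_in_gluing_subset[OF _ refl_trans_block])
       simp
  have a: "(p, q) \<in> ?L" "(q, p) \<in> ?L"
    by (rule connected_in_gluing_arc[of "{p, q}"], simp_all)+
  show "?R \<subseteq> ?L"
    by (rule block_subset[OF connected_in_gluing_refl])
       (simp add: a connected_in_gluing_refl)
qed

lemma connected_sharing:
  "connected_in_gluing {{p, q}} {{q, r}} = Id \<union> {p, q, r} \<times> {p, q, r}" (is "?L = ?R")
proof
  show "?L \<subseteq> ?R"
    by (rule connected_in_gluing_subset[OF _ refl_trans_block])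
       simp
  have a: "(p, q) \<in> ?L" "(q, p) \<in> ?L"
    by (rule connected_in_gluing_arc[of "{p, q}"], simp_all)+
  have a': "(q, r) \<in> ?L" "(r, q) \<in> ?L"
    by (rule connected_in_gluing_arc[of "{q, r}"], simp_all)+
  have b: "(p, r) \<in> ?L" "(r, p) \<in> ?L"
    by (rule connected_in_gluing_trans[OF a(1) a'(1)], rule connected_in_gluing_trans[OF a'(2) a(2)])
  show "?R \<subseteq> ?L"
    by (rule block_subset[OF connected_in_gluing_refl])
       (simp add: a a' b connected_in_gluing_refl)
qed

lemma connected_disjoint:
  assumes "{p, q} \<inter> {r, s} = {}"
  shows "connected_in_gluing {{p, q}} {{r, s}} \<subseteq> Id \<union> {p, q} \<times> {p, q} \<union> {r, s} \<times> {r, s}"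
  by (rule connected_in_gluing_subset[OF _ refl_trans_blocks[OF assms]])
     simp

lemma line_number_arc:
  assumes "1 \<le> p" "1 \<le> q" "p \<noteq> q" "a \<le> n"
  shows "line_number n {{p, q}} a = a - of_bool (p \<le> a) - of_bool (q \<le> a)"
proof -
  have "{b \<in> line_vertices n {{p, q}}. b \<le> a} = {1..a} - {p, q}"
    using assms by (auto simp: line_vertices_def)
  also have "\<dots> = {1..a} - {p, q} \<inter> {1..a}" by auto
  finally have "line_number n {{p, q}} a = a - card ({p, q} \<inter> {1..a})"
    by (simp add: line_number_def card_Diff_subset)
  also have "card ({p, q} \<inter> {1..a}) = of_bool (p \<le> a) + of_bool (q \<le> a)"
    using assms by (auto simp: Int_insert_left)
  finally show ?thesis by simp
qed

lemma contravariant_form_equal: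
  assumes "p \<in> {1..n}" "q \<in> {1..n}" "p \<noteq> q"
  shows "contravariant_form \<delta> l n {{p, q}} {{p, q}} = \<delta>"
proof -
  let ?u = "{{p, q}}"
  have pl: "propagating_lines n ?u ?u = Id_on ({1..n} - {p, q})"
    by (auto simp: propagating_lines_def connected_equal line_vertices_def)
  have "card ({1..n} - {p, q}) = n - 2"
    using assms by (subst card_Diff_subset) auto
  moreover have "Id_on ({1..n} - {p, q}) = (\<lambda>a. (a, a)) ` ({1..n} - {p, q})"
    by auto
  ultimately have "card (propagating_lines n ?u ?u) = n - 2"
    unfolding pl by (simp add: card_image inj_on_def)
  moreover have "induces_permutation n ?u ?u id"
    by (auto simp: induces_permutation_def pl)
  moreover have "closed_loops n ?u ?u = {{p, q}}"
  proof -
    have cl: "connected_in_gluing ?u ?u `` {a} = (if a \<in> {p, q} then {p, q} else {a})" for a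
      by (auto simp: connected_equal)
    show ?thesis
      using assms
      by (auto simp: closed_loops_def quotient_def cl line_vertices_def split: if_splits)
  qed
  ultimately show ?thesis
    by (simp add: contravariant_form_def)
qed

lemma contravariant_form_disjoint:
  assumes "p \<in> {1..n}" "q \<in> {1..n}" "r \<in> {1..n}" "s \<in> {1..n}" "p \<noteq> q" "r \<noteq> s"
    and "{p, q} \<inter> {r, s} = {}"
  shows "contravariant_form \<delta> l n {{p, q}} {{r, s}} = 0"
proof -
  let ?A = "{1..n} - {p, q, r, s}"
  have "propagating_lines n {{p, q}} {{r, s}} \<subseteq> (\<lambda>a. (a, a)) ` ?A"
    using connected_disjoint[OF assms(7)]
    by (auto simp: propagating_lines_def line_vertices_def)
  then have "card (propagating_lines n {{p, q}} {{r, s}}) \<le> card ?A"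
    by (meson card_image_le card_mono finite_Diff finite_atLeastAtMost finite_imageI le_trans)
  moreover have "card ?A = n - 4"
    using assms by (subst card_Diff_subset) auto
  moreover have "n \<ge> 4"
  proof -
    have "card {p, q, r, s} \<le> card {1..n}"
      using assms by (intro card_mono) auto
    then show ?thesis using assms by auto
  qed
  ultimately show ?thesis
    by (simp add: contravariant_form_def)
qed

lemma contravariant_form_sharing:
  assumes "p \<in> {1..n}" "q \<in> {1..n}" "r \<in> {1..n}" "p \<noteq> q" "q \<noteq> r" "p \<noteq> r"
  defines "P \<equiv> \<lambda>\<sigma>::nat \<Rightarrow> nat.
      p - of_bool (q \<le> p) - of_bool (r \<le> p) = \<sigma> (r - of_bool (p \<le> r) - of_bool (q \<le> r)) \<and>
      (\<forall>a \<in> {1..n} - {p, q, r}.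
         a - of_bool (q \<le> a) - of_bool (r \<le> a) = \<sigma> (a - of_bool (p \<le> a) - of_bool (q \<le> a)))"
  shows "contravariant_form \<delta> l n {{p, q}} {{q, r}} =
    (if P id then 1 else if P (transpose 1 2) then label_sign l else 0)"
proof -
  let ?u = "{{p, q}}" and ?v = "{{q, r}}" and ?A = "{1..n} - {p, q, r}"
  have pl: "propagating_lines n ?u ?v = insert (r, p) ((\<lambda>a. (a, a)) ` ?A)"
    using assms(1-6) by (auto simp: propagating_lines_def connected_sharing line_vertices_def)
  have "card ?A = n - 3"
    using assms(1-6) by (subst card_Diff_subset) auto
  moreover have "n \<ge> 3"
  proof -
    have "card {p, q, r} \<le> card {1..n}"
      using assms(1-6) by (intro card_mono) auto
    then show ?thesis using assms(1-6) by auto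
  qed
  moreover have "(r, p) \<notin> (\<lambda>a. (a, a)) ` ?A" using assms(1-6) by auto
  ultimately have "card (propagating_lines n ?u ?v) = n - 2"
    unfolding pl by (simp add: card_image inj_on_def)
  moreover have "induces_permutation n ?u ?v \<sigma> \<longleftrightarrow> P \<sigma>" for \<sigma>
    using assms(1-6) by (simp add: induces_permutation_def pl line_number_arc P_def)
  moreover have "closed_loops n ?u ?v = {}"
  proof -
    have False if C: "C \<in> closed_loops n ?u ?v" for C
    proof -
      obtain a where a: "a \<in> {1..n}" "C = connected_in_gluing ?u ?v `` {a}"
        using C by (auto simp: closed_loops_def quotient_def)
      have "C \<inter> line_vertices n ?u = {}"
        using C by (simp add: closed_loops_def)
      moreover have "(if a \<in> {p, q, r} then r else a) \<in> C \<inter> line_vertices n ?u"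
        using assms(1-6) a by (auto simp: connected_sharing line_vertices_def)
      ultimately show False by simp
    qed
    then show ?thesis by blast
  qed
  ultimately show ?thesis
    by (simp add: contravariant_form_def)
qed

lemma contravariant_form_sharing_trivial:
  assumes "p \<in> {1..n}" "q \<in> {1..n}" "r \<in> {1..n}" "p \<noteq> q" "q \<noteq> r" "p \<noteq> r"
    and "p - of_bool (q \<le> p) - of_bool (r \<le> p) = id (r - of_bool (p \<le> r) - of_bool (q \<le> r))"
    and "\<And>a. a \<in> {1..n} - {p, q, r} \<Longrightarrow>
      a - of_bool (q \<le> a) - of_bool (r \<le> a) = id (a - of_bool (p \<le> a) - of_bool (q \<le> a))"
  shows "contravariant_form \<delta> l n {{p, q}} {{q, r}} = 1"
  unfolding contravariant_form_sharing[OF assms(1-6)]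
  by (intro if_P conjI ballI assms(7,8))

lemma gram_matrix_index:
  assumes n: "n \<ge> 4" and "i < n" "j < n"
  shows "gram_matrix \<delta> l n $$ (i, j) =
    (if i = j then \<delta>
     else if {i, j} = {1, 3} then label_sign l
     else if {i, j} = {0, 2} \<or> j = Suc i \<or> i = Suc j then 1
     else 0)"
proof -
  let ?f = "\<lambda>i j. contravariant_form \<delta> l n (basis_diagram (Suc i)) (basis_diagram (Suc j))"
  have [simp]: "(if b then (1::nat) else 0) = of_bool b" for b by simp
  have gram: "gram_matrix \<delta> l n $$ (i, j) = ?f i j"
    using assms by (simp add: gram_matrix_def)
  have b0: "basis_diagram (Suc 0) = {{1, 2}}" "basis_diagram (Suc 0) = {{2, 1}}"
    and b1: "basis_diagram (Suc 1) = {{1, 3}}" "basis_diagram (Suc 1) = {{3, 1}}"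
    and b2: "basis_diagram (Suc 2) = {{2, 3}}" "basis_diagram (Suc 2) = {{3, 2}}"
    and b3: "basis_diagram (Suc 3) = {{3, 4}}" "basis_diagram (Suc 3) = {{4, 3}}"
    and b: "k \<ge> 2 \<Longrightarrow> basis_diagram (Suc k) = {{k, Suc k}}"
           "k \<ge> 2 \<Longrightarrow> basis_diagram (Suc k) = {{Suc k, k}}" for k
    by (auto simp: basis_diagram_def basis_arc_def insert_commute)
  have f01: "?f 0 1 = 1"
    unfolding b0(2) b1(1) using n by (subst contravariant_form_sharing) auto
  have f10: "?f 1 0 = 1"
    unfolding b0(1) b1(2) using n by (subst contravariant_form_sharing) auto
  have f02: "?f 0 2 = 1"
    unfolding b0(1) b2(1) using n by (subst contravariant_form_sharing) auto
  have f20: "?f 2 0 = 1"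
    unfolding b0(2) b2(2) using n by (subst contravariant_form_sharing) auto
  have f12: "?f 1 2 = 1"
    unfolding b1(1) b2(2) using n by (subst contravariant_form_sharing) auto
  have f21: "?f 2 1 = 1"
    unfolding b1(2) b2(1) using n by (subst contravariant_form_sharing) auto
  have f13: "?f 1 3 = label_sign l"
    unfolding b1(1) b3(1) using n
    by (subst contravariant_form_sharing) (auto simp: transpose_def intro: bexI[of _ 2])
  have f31: "?f 3 1 = label_sign l"
    unfolding b1(2) b3(2) using n
    by (subst contravariant_form_sharing) (auto simp: transpose_def intro: bexI[of _ 2])
  have up: "?f k (Suc k) = 1" if "k \<ge> 2" "Suc k < n" for k
  proof -
    have *: "a - of_bool (Suc k \<le> a) - of_bool (Suc (Suc k) \<le> a) =
        id (a - of_bool (k \<le> a) - of_bool (Suc k \<le> a))"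
      if "a \<in> {1..n} - {k, Suc k, Suc (Suc k)}" for a
    proof (cases "a < k")
      case False
      then have "Suc (Suc k) \<le> a" "Suc k \<le> a" "k \<le> a" using that by simp_all
      then show ?thesis by simp
    qed simp
    show ?thesis
      unfolding b(1)[OF that(1)] b(1)[OF le_SucI[OF that(1)]]
      by (rule contravariant_form_sharing_trivial[OF _ _ _ _ _ _ _ *]) (use that in simp_all)
  qed
  have down: "?f (Suc k) k = 1" if "k \<ge> 2" "Suc k < n" for k
  proof -
    have *: "a - of_bool (Suc k \<le> a) - of_bool (k \<le> a) =
        id (a - of_bool (Suc (Suc k) \<le> a) - of_bool (Suc k \<le> a))"
      if "a \<in> {1..n} - {Suc (Suc k), Suc k, k}" for a
    proof (cases "a < k")
      case False
      then have "Suc (Suc k) \<le> a" "Suc k \<le> a" "k \<le> a" using that by simp_all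
      then show ?thesis by simp
    qed simp
    show ?thesis
      unfolding b(2)[OF that(1)] b(2)[OF le_SucI[OF that(1)]]
      by (rule contravariant_form_sharing_trivial[OF _ _ _ _ _ _ _ *]) (use that in simp_all)
  qed
  have diag: "?f k k = \<delta>" if "k < n" for k
    using that n unfolding basis_diagram_def basis_arc_def
    by (auto simp: contravariant_form_equal)
  have zero: "?f i j = 0"
    if "i \<noteq> j" "{i, j} \<noteq> {1, 3}" "{i, j} \<noteq> {0, 2}" "j \<noteq> Suc i" "i \<noteq> Suc j"
  proof -
    define P where "P k = (if k \<le> 1 then 1 else k)" for k :: nat
    define Q where "Q k = (if k \<le> 1 then k + 2 else Suc k)" for k
    have bd: "basis_diagram (Suc k) = {{P k, Q k}}" for k
      by (auto simp: basis_diagram_def basis_arc_def P_def Q_def)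
    have ne: "\<not> (i = 1 \<and> j = 3)" "\<not> (i = 3 \<and> j = 1)" "\<not> (i = 0 \<and> j = 2)" "\<not> (i = 2 \<and> j = 0)"
      using that(2,3) by (auto simp: insert_commute)
    have "P i \<noteq> P j \<and> P i \<noteq> Q j \<and> Q i \<noteq> P j \<and> Q i \<noteq> Q j"
      using that(1,4,5) ne unfolding P_def Q_def by presburger
    then have "{P i, Q i} \<inter> {P j, Q j} = {}" by simp
    moreover have "P k \<in> {1..n}" "Q k \<in> {1..n}" "P k \<noteq> Q k" if "k < n" for k
      using that n by (simp_all add: P_def Q_def)
    ultimately show ?thesis
      unfolding bd using assms by (simp add: contravariant_form_disjoint)
  qed
  have s1: "?f i j = 1" if "j = Suc i"
  proof -
    consider "i = 0" | "i = 1" | "i \<ge> 2" by linarith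
    then show ?thesis
    proof cases
      case 1
      then show ?thesis using f01 that by simp
    next
      case 2
      then have "j = 2" using that by simp
      then show ?thesis using f12 2 by simp
    next
      case 3
      then show ?thesis using up[of i] that \<open>j < n\<close> by simp
    qed
  qed
  have s2: "?f i j = 1" if "i = Suc j"
  proof -
    consider "j = 0" | "j = 1" | "j \<ge> 2" by linarith
    then show ?thesis
    proof cases
      case 1
      then show ?thesis using f10 that by simp
    next
      case 2
      then have "i = 2" using that by simp
      then show ?thesis using f21 2 by simp
    next
      case 3
      then show ?thesis using down[of j] that \<open>i < n\<close> by simp
    qed
  qed
  have t: "?f i j = label_sign l" if "{i, j} = {1, 3}"
    using that f13 f31 unfolding doubleton_eq_iff by metis
  have u: "?f i j = 1" if "{i, j} = {0, 2}"
    using that f02 f20 unfolding doubleton_eq_iff by metis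
  show ?thesis
    unfolding gram using diag[OF \<open>i < n\<close>] s1 s2 t u zero by presburger
qed

end

theory Submission
  imports Defs
begin

text \<open>
  Write \<open>\<epsilon>\<close> for the sign of the label. Apart from the entries \<open>{0, 2}\<close> and \<open>{1, 3}\<close> the Gram matrix
  is tridiagonal with \<open>X\<close> on the diagonal and 1 next to it, and these two exceptional pairs lie in
  its leading \<open>4 \<times> 4\<close> block. Expanding along the last row and column (\<open>det_tridiagonal_step\<close>)
  therefore gives \<open>D (k + 2) = X * D (k + 1) - D k\<close> as soon as \<open>k \<ge> 3\<close>, which is the Chebyshev
  recurrence. So \<open>D n\<close> is determined by its values at 3 and 4, and these are found directly:
  \<open>D 3 = (X - 1)\<^sup>2 * (X + 2)\<close> and \<open>D 4 = X * D 3 - (X - 1) * c\<close> with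
  \<open>c = (\<epsilon>\<^sup>2 + 1) * (X + 1) - 2 * \<epsilon>\<close>. Hence
  \<open>D n = (X - 1) * ((X + 2) * (X - 1) * d (n - 3) - c * d (n - 4))\<close> for every \<open>\<epsilon>\<close>.
  The two labels only differ in \<open>c\<close>, which is \<open>2 * X\<close> for \<open>\<epsilon> = 1\<close> and \<open>2 * (X + 2)\<close> for
  \<open>\<epsilon> = -1\<close>; the latter is why \<open>X + 2\<close> splits off in the antisymmetric case.
\<close>

lemma det_mat_expand_last_row:
  fixes f :: "nat \<times> nat \<Rightarrow> 'a::comm_ring_1"
  shows "det (mat (Suc n) (Suc n) f) =
    (\<Sum>j<Suc n. f (n, j) * ((-1) ^ (n + j) *
       det (mat n n (\<lambda>(i, k). f (i, if k < j then k else Suc k)))))"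
proof -
  let ?A = "mat (Suc n) (Suc n) f"
  have del: "mat_delete ?A n j = mat n n (\<lambda>(i, k). f (i, if k < j then k else Suc k))"
    if "j < Suc n" for j
    by (rule eq_matI) (auto simp: mat_delete_def)
  show ?thesis
    by (subst laplace_expansion_row[of ?A "Suc n" n])
       (auto simp: cofactor_def del intro!: sum.cong)
qed

lemma det_mat_last_column_single:
  fixes f :: "nat \<times> nat \<Rightarrow> 'a::comm_ring_1"
  assumes "\<And>i. i < n \<Longrightarrow> f (i, n) = 0"
  shows "det (mat (Suc n) (Suc n) f) = f (n, n) * det (mat n n f)"
proof -
  let ?A = "mat (Suc n) (Suc n) f"
  have del: "mat_delete ?A n n = mat n n f"
    by (rule eq_matI) (auto simp: mat_delete_def)
  have "det ?A = (\<Sum>i<Suc n. ?A $$ (i, n) * cofactor ?A i n)"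
    by (rule laplace_expansion_column) auto
  also have "\<dots> = f (n, n) * det (mat n n f)"
    by (simp add: assms cofactor_def del)
  finally show ?thesis .
qed

text \<open>
  Only two terms survive in the expansion along the last row. The minor of the off-diagonal one
  keeps the old last column, whose only possibly nonzero entry is at its bottom, so it collapses
  once more. The leading block may be arbitrary; this is what allows the exceptional entries there.
\<close>

lemma det_tridiagonal_step:
  fixes f :: "nat \<times> nat \<Rightarrow> 'a::comm_ring_1"
  assumes row: "\<And>j. j < n \<Longrightarrow> f (Suc n, j) = 0"
    and column: "\<And>i. i < n \<Longrightarrow> f (i, Suc n) = 0"
  shows "det (mat (Suc (Suc n)) (Suc (Suc n)) f) =
    f (Suc n, Suc n) * det (mat (Suc n) (Suc n) f) -
    f (Suc n, n) * f (n, Suc n) * det (mat n n f)"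
proof -
  let ?g = "\<lambda>j (i, k). f (i, if k < j then k else Suc k)"
  have same: "mat (Suc n) (Suc n) (?g (Suc n)) = mat (Suc n) (Suc n) f"
    "mat n n (?g n) = mat n n f"
    by (rule eq_matI; simp)+
  have "det (mat (Suc n) (Suc n) (?g n)) = f (n, Suc n) * det (mat n n f)"
    using det_mat_last_column_single[of n "?g n"] by (simp add: column same)
  then show ?thesis
    by (subst det_mat_expand_last_row) (simp add: row same)
qed

text \<open>
  The entry pattern of the Gram matrix makes sense in every size; the recurrence starts from its
  \<open>3 \<times> 3\<close> block, where the sign does not occur yet.
\<close>

definition gram_pattern :: "'a::comm_ring_1 \<Rightarrow> 'a \<Rightarrow> nat \<times> nat \<Rightarrow> 'a" where
  "gram_pattern \<delta> \<epsilon> = (\<lambda>(i, j).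
     if i = j then \<delta>
     else if {i, j} = {1, 3} then \<epsilon>
     else if {i, j} = {0, 2} \<or> j = Suc i \<or> i = Suc j then 1
     else 0)"

lemma gram_matrix_eq_pattern:
  assumes "n \<ge> 4"
  shows "gram_matrix \<delta> l n = mat n n (gram_pattern \<delta> (label_sign l))"
proof (rule eq_matI)
  show "gram_matrix \<delta> l n $$ (i, j) = mat n n (gram_pattern \<delta> (label_sign l)) $$ (i, j)"
    if "i < dim_row (mat n n (gram_pattern \<delta> (label_sign l)))"
      "j < dim_col (mat n n (gram_pattern \<delta> (label_sign l)))" for i j
    using that assms by (simp add: gram_matrix_index gram_pattern_def)
qed (simp_all add: gram_matrix_def)

lemma det_gram_pattern_3:
  "det (mat 3 3 (gram_pattern \<delta> \<epsilon>)) = (\<delta> - 1) * ((\<delta> + 2) * (\<delta> - 1))"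
  by (simp add: numeral_3_eq_3 det_mat_expand_last_row gram_pattern_def doubleton_eq_iff)
     (simp add: algebra_simps)

lemma det_gram_pattern_4:
  "det (mat 4 4 (gram_pattern \<delta> \<epsilon>)) =
   (\<delta> - 1) * ((\<delta> + 2) * (\<delta> - 1) * \<delta> - ((\<epsilon>\<^sup>2 + 1) * (\<delta> + 1) - 2 * \<epsilon>))"
proof -
  have 4: "(4::nat) = Suc (Suc (Suc (Suc 0)))" by simp
  show ?thesis
    unfolding 4
    by (simp add: det_mat_expand_last_row gram_pattern_def doubleton_eq_iff)
       (simp add: algebra_simps power2_eq_square)
qed

text \<open>
  For \<open>k = 2\<close> this would fail: the last row of the \<open>4 \<times> 4\<close> pattern contains \<open>\<epsilon>\<close> two places
  before the diagonal.
\<close>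

lemma det_gram_pattern_step:
  assumes "k \<ge> 3"
  shows "det (mat (Suc (Suc k)) (Suc (Suc k)) (gram_pattern \<delta> \<epsilon>)) =
    \<delta> * det (mat (Suc k) (Suc k) (gram_pattern \<delta> \<epsilon>)) - det (mat k k (gram_pattern \<delta> \<epsilon>))"
  using assms
  by (subst det_tridiagonal_step) (auto simp: gram_pattern_def doubleton_eq_iff)

text \<open>
  The Chebyshev recurrence is linear, so it passes to combinations of two consecutive terms
  \<open>p, q, r\<close>. The identity is stated for ring elements because simplification would rewrite
  the concrete polynomial \<open>X\<close>.
\<close>

lemma recurrence_combination:
  fixes x :: "'a::comm_ring_1"
  shows "x * (a * (b * p - c * q)) - a * (b * q - c * r) =
    a * (b * (x * p - q) - c * (x * q - r))"
  by (simp add: algebra_simps)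

lemma det_gram_pattern:
  fixes \<epsilon> :: "'a::comm_ring_1 poly"
  shows "det (mat (m + 4) (m + 4) (gram_pattern X \<epsilon>)) =
    (X - 1) * ((X + 2) * (X - 1) * chebyshev (Suc m) -
      ((\<epsilon>\<^sup>2 + 1) * (X + 1) - 2 * \<epsilon>) * chebyshev m)"
proof (induction m rule: chebyshev.induct)
  case 1
  then show ?case using det_gram_pattern_4[of X \<epsilon>] by simp
next
  case 2
  have "det (mat 5 5 (gram_pattern X \<epsilon>)) =
      X * det (mat 4 4 (gram_pattern X \<epsilon>)) - det (mat 3 3 (gram_pattern X \<epsilon>))"
    using det_gram_pattern_step[of 3 X \<epsilon>] by (simp add: eval_nat_numeral)
  also have "\<dots> = (X - 1) * ((X + 2) * (X - 1) * (X * X - 1) -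
      ((\<epsilon>\<^sup>2 + 1) * (X + 1) - 2 * \<epsilon>) * X)"
    unfolding det_gram_pattern_3 det_gram_pattern_4
    \<comment> \<open>The value at 3 fits the general formula with \<open>d 0 = 1\<close> and \<open>d (-1) = 0\<close>.\<close>
    using recurrence_combination[of X "X - 1" "(X + 2) * (X - 1)" X
        "(\<epsilon>\<^sup>2 + 1) * (X + 1) - 2 * \<epsilon>" 1 0]
    by (simp only: mult_1_right mult_zero_right diff_zero)
  finally show ?case by simp
next
  case (3 m)
  have "det (mat (Suc (Suc m) + 4) (Suc (Suc m) + 4) (gram_pattern X \<epsilon>)) =
      X * det (mat (Suc m + 4) (Suc m + 4) (gram_pattern X \<epsilon>)) -
      det (mat (m + 4) (m + 4) (gram_pattern X \<epsilon>))"
    using det_gram_pattern_step[of "m + 4" X \<epsilon>] by simp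
  also have "\<dots> = (X - 1) * ((X + 2) * (X - 1) *
        (X * chebyshev (Suc (Suc m)) - chebyshev (Suc m)) -
      ((\<epsilon>\<^sup>2 + 1) * (X + 1) - 2 * \<epsilon>) * (X * chebyshev (Suc m) - chebyshev m))"
    unfolding 3 by (rule recurrence_combination)
  finally show ?case
    by (simp only: chebyshev.simps)
qed

lemma label_specialisation:
  fixes x :: "'a::comm_ring_1"
  shows "(x - 1) * ((x + 2) * (x - 1) * p - ((1\<^sup>2 + 1) * (x + 1) - 2 * 1) * q) =
      (x - 1) * ((x + 2) * (x - 1) * p - 2 * x * q)"
    and "(x - 1) * ((x + 2) * (x - 1) * p - (((-1)\<^sup>2 + 1) * (x + 1) - 2 * (-1)) * q) =
      (x - 1) * (x + 2) * ((x - 1) * p - 2 * q)"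
proof -
  have c: "(1\<^sup>2 + 1) * (x + 1) - 2 * 1 = 2 * x"
    "((-1)\<^sup>2 + 1) * (x + 1) - 2 * (-1) = (x + 2) * 2"
    by (simp_all add: distrib_left distrib_right)
  have factor: "a * (b * a * p - b * 2 * q) = a * b * (a * p - 2 * q)" for a b
    by (simp add: right_diff_distrib mult.assoc)
  show "(x - 1) * ((x + 2) * (x - 1) * p - ((1\<^sup>2 + 1) * (x + 1) - 2 * 1) * q) =
      (x - 1) * ((x + 2) * (x - 1) * p - 2 * x * q)"
    by (simp only: c)
  show "(x - 1) * ((x + 2) * (x - 1) * p - (((-1)\<^sup>2 + 1) * (x + 1) - 2 * (-1)) * q) =
      (x - 1) * (x + 2) * ((x - 1) * p - 2 * q)"
    unfolding c by (rule factor)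
qed

theorem mainTheorem4:
  fixes n :: nat
  assumes "n \<ge> 4"
  shows "det (gram_matrix (X :: 'a::comm_ring_1 poly) Sym_label n) =
           (X - 1) * ((X + 2) * (X - 1) * chebyshev (n - 3) - 2 * X * chebyshev (n - 4))
         \<and> det (gram_matrix (X :: 'a::comm_ring_1 poly) Antisym_label n) =
           (X - 1) * (X + 2) * ((X - 1) * chebyshev (n - 3) - 2 * chebyshev (n - 4))"
proof -
  obtain m where m: "n = m + 4"
    using assms by (metis add.commute le_iff_add)
  have d: "chebyshev (n - 3) = (chebyshev (Suc m) :: 'a poly)"
    "chebyshev (n - 4) = (chebyshev m :: 'a poly)"
    by (simp_all add: m eval_nat_numeral)
  have det: "det (gram_matrix (X :: 'a poly) l n) =
      (X - 1) * ((X + 2) * (X - 1) * chebyshev (Suc m) -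
        (((label_sign l)\<^sup>2 + 1) * (X + 1) - 2 * label_sign l) * chebyshev m)" for l
    unfolding gram_matrix_eq_pattern[OF assms] unfolding m by (rule det_gram_pattern)
  show ?thesis
    unfolding det d label_sign.simps by (intro conjI label_specialisation)
qed

end
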